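(* Let $p\geq 1$ and $k\geq 0$ be integers. Then $$\begin{aligned}(-1)^p\,\Gamma(2p)\,&\frac{E_{2p}\bigl(-i\pi(k+\frac12)\bigr)+E_{2p}\bigl(i\pi(k+\frac12)\bigr)}{\bigl(\pi(k+\frac12)\bigr)^{2p-1}}\\&=2(-1)^k\sum_{j=1}^{p-1}\frac{(-1)^j\,\Gamma(2j)}{\bigl(\pi(k+\frac12)\bigr)^{2j}}-2\Bigl(\mathrm{Si}\bigl(\pi(k+\tfrac12)\bigr)-\frac{\pi}{2}\Bigr).\end{aligned}$$
   Context: $E_{2p}(\pm i\kappa)=\int_1^\infty v^{-2p}e^{\mp i\kappa v}\,dv$ for $\kappa>0$ is the exponential integral, and $\mathrm{Si}(z)=\int_0^z\frac{\sin t}{t}\,dt$ is the sine integral. A sum whose lower limit exceeds its upper limit is zero. *)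

theory Defs
  imports "HOL-Analysis.Analysis" "HOL-Probability.Sinc_Integral"
begin

(* The integral is absolutely convergent for n >= 2 and Re z >= 0; outside the region of
   absolute convergence the Lebesgue integral has the default value 0, so the definition is
   meaningful on the imaginary axis only for n >= 2. The sine integral is Si from
   HOL-Probability.Sinc_Integral. *)
definition E :: "nat \<Rightarrow> complex \<Rightarrow> complex" where
  "E n z = (LINT v:{1..}|lborel. exp (- z * of_real v) / of_real v ^ n)"

lemma set_integrable_E:
  assumes "n \<ge> 2" "Re z \<ge> 0"
  shows "set_integrable lborel {1..} (\<lambda>v. exp (- z * of_real v) / of_real v ^ n :: complex)"
proof (rule set_integrable_bound)
  have "set_integrable lebesgue {1..} (\<lambda>v. v powr -2 :: real)"
    using has_integral_powr_to_inf[of "-2" 1]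
    by (intro nonnegative_absolutely_integrable_1) (auto simp: has_integral_iff)
  then show "set_integrable lborel {1..} (\<lambda>v. v powr -2 :: real)"
    by (simp add: set_integrable_def integrable_completion)
  show "set_borel_measurable lborel {1..} (\<lambda>v. exp (- z * of_real v) / of_real v ^ n :: complex)"
    unfolding set_borel_measurable_def by measurable
  have "norm (exp (- z * of_real v) / of_real v ^ n) \<le> norm (v powr -2)" if "v \<ge> 1" for v
  proof -
    have "v ^ 2 \<le> v ^ n" using assms that by (intro power_increasing) auto
    moreover have "exp (- (Re z * v)) \<le> 1" using assms that by simp
    ultimately have "exp (- (Re z * v)) / v ^ n \<le> 1 / v ^ 2"
      using that by (intro frac_le) auto
    then show ?thesis
      using that by (simp add: norm_divide norm_mult norm_inverse norm_power powr_minus powr_numeral divide_inverse)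
  qed
  then show "AE v in lborel. v \<in> {1..} \<longrightarrow>
      norm (exp (- z * of_real v) / of_real v ^ n) \<le> norm (v powr -2)"
    by simp
qed

end

theory Submission
  imports Defs
begin

text \<open>
  On the imaginary axis the two exponential integrals are complex conjugates, so their sum is twice
  the cosine integral \<open>C n = \<integral> cos (x v) / v ^ n dv\<close> over \<open>{1..}\<close>, and the claim is an induction
  on \<open>p\<close> about \<open>C (2 * p)\<close>. Both the base case and the step come from integration by parts, whose
  boundary terms simplify at \<open>x = \<pi> * (k + 1/2)\<close>, because there \<open>cos x = 0\<close> and \<open>sin x = (-1) ^ k\<close>.

  In the base case one integration by parts leaves the integral of \<open>sin (x v) / v\<close>, which is the
  tail \<open>\<pi> / 2 - Si x\<close> of the sine integral. This integral converges only conditionally, so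
  \<open>cosine_integral_2\<close> hides it in the antiderivative \<open>cos (x v) / v + x * Si (x v)\<close>. In the step two
  integrations by parts relate \<open>C (m + 2)\<close> to \<open>C m\<close> (lemma \<open>cosine_integral_recurrence\<close>); each
  use of this relation contributes one boundary term, and these boundary terms are the summands
  of the finite sum.
\<close>

lemma lborel_integral_FTC_atLeast:
  fixes f F :: "real \<Rightarrow> real"
  assumes deriv: "\<And>v. v \<ge> a \<Longrightarrow> (F has_real_derivative f v) (at v)"
    and cont: "continuous_on {a..} f"
    and int: "set_integrable lborel {a..} f"
    and lim: "(F \<longlongrightarrow> L) at_top"
  shows "(LINT v:{a..}|lborel. f v) = L - F a"
proof (rule tendsto_unique)
  show "((\<lambda>b. LINT v:{a..b}|lborel. f v) \<longlongrightarrow> (LINT v:{a..}|lborel. f v)) at_top"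
    by (intro tendsto_set_lebesgue_integral_at_top int) auto
  have "\<forall>\<^sub>F b in at_top. F b - F a = (LINT v:{a..b}|lborel. f v)"
    using eventually_ge_at_top[of a]
  proof eventually_elim
    case (elim b)
    have "(LBINT v. indicator {a..b} v *\<^sub>R f v) = F b - F a"
    proof (rule integral_FTC_Icc)
      show "(F has_vector_derivative f v) (at v within {a..b})" if "a \<le> v" "v \<le> b" for v
        by (rule has_vector_derivative_at_within)
           (rule deriv[OF that(1), unfolded has_real_derivative_iff_has_vector_derivative])
      show "continuous_on {a..b} f"
        by (rule continuous_on_subset[OF cont]) auto
    qed (rule elim)
    then show ?case
      by (simp add: set_lebesgue_integral_def)
  qed
  moreover have "((\<lambda>b. F b - F a) \<longlongrightarrow> L - F a) at_top"
    by (intro tendsto_intros lim)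
  ultimately show "((\<lambda>b. LINT v:{a..b}|lborel. f v) \<longlongrightarrow> L - F a) at_top"
    by (rule Lim_transform_eventually[rotated])
qed simp

definition cosine_integral :: "nat \<Rightarrow> real \<Rightarrow> real" where
  "cosine_integral n x = (LINT v:{1..}|lborel. cos (x * v) / v ^ n)"

lemma exp_imaginary_add_exp_minus:
  "exp (\<i> * of_real t) + exp (- (\<i> * of_real t)) = of_real (2 * cos t)"
  by (simp add: cos_exp_eq cos_of_real[symmetric])

lemma set_integrable_cosine:
  assumes "n \<ge> 2"
  shows "set_integrable lborel {1..} (\<lambda>v. cos (x * v) / v ^ n :: real)"
proof -
  have "set_integrable lborel {1..} (\<lambda>v. Re (exp (- (\<i> * of_real x) * of_real v) / of_real v ^ n))"
    using assms set_integrable_E[of n "\<i> * of_real x"]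
    unfolding set_integrable_def by (auto dest: integrable_Re)
  also have "(\<lambda>v. Re (exp (- (\<i> * of_real x) * of_real v) / of_real v ^ n)) = (\<lambda>v. cos (x * v) / v ^ n)"
    by (simp add: Re_exp flip: of_real_power)
  finally show ?thesis .
qed

lemma E_imaginary_add_E_minus:
  assumes "n \<ge> 2"
  shows "E n (- \<i> * of_real x) + E n (\<i> * of_real x) = of_real (2 * cosine_integral n x)"
proof -
  have "E n (- \<i> * of_real x) + E n (\<i> * of_real x) =
      (LINT v:{1..}|lborel. exp (- (- \<i> * of_real x) * of_real v) / of_real v ^ n +
                            exp (- (\<i> * of_real x) * of_real v) / of_real v ^ n)"
    unfolding E_def using assms by (intro set_integral_add(2)[symmetric] set_integrable_E) auto
  also have "\<dots> = (LINT v:{1..}|lborel. complex_of_real (2 * (cos (x * v) / v ^ n)))"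
  proof (rule arg_cong[where f = "set_lebesgue_integral lborel {1..}"], rule ext)
    fix v :: real
    show "exp (- (- \<i> * of_real x) * of_real v) / of_real v ^ n +
          exp (- (\<i> * of_real x) * of_real v) / of_real v ^ n =
          complex_of_real (2 * (cos (x * v) / v ^ n))"
      using exp_imaginary_add_exp_minus[of "x * v"]
      by (simp add: mult.assoc flip: add_divide_distrib)
  qed
  also have "\<dots> = of_real (2 * cosine_integral n x)"
    by (simp only: set_integral_complex_of_real set_integral_mult_right cosine_integral_def)
  finally show ?thesis .
qed

lemma tendsto_bounded_div_power_0:
  fixes g :: "real \<Rightarrow> real"
  assumes "n > 0" "\<And>v. \<bar>g v\<bar> \<le> 1"
  shows "((\<lambda>v. g v / v ^ n) \<longlongrightarrow> 0) at_top"
proof (rule Lim_null_comparison)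
  show "((\<lambda>v::real. inverse (v ^ n)) \<longlongrightarrow> 0) at_top"
    using assms(1) by (intro tendsto_inverse_0_at_top filterlim_pow_at_top filterlim_ident)
  show "\<forall>\<^sub>F v in at_top. norm (g v / v ^ n) \<le> inverse (v ^ n)"
    using eventually_gt_at_top[of 0]
    by eventually_elim (use assms(2) in \<open>auto simp: divide_inverse abs_mult intro!: mult_left_le_one_le\<close>)
qed

lemma cosine_integral_2:
  assumes "x > 0"
  shows "cosine_integral 2 x = cos x - x * (pi / 2 - Si x)"
proof -
  \<comment> \<open>The exponent \<open>1\<close> is written out so that \<open>tendsto_bounded_div_power_0\<close> applies to this term.\<close>
  define F where "F = (\<lambda>v. cos (x * v) / v ^ 1 + x * Si (x * v))"
  have "(LINT v:{1..}|lborel. - (cos (x * v) / v ^ 2)) = (0 + x * (pi / 2)) - F 1"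
  proof (rule lborel_integral_FTC_atLeast)
    fix v :: real assume "v \<ge> 1"
    then have v: "v \<noteq> 0" "x * v \<noteq> 0"
      using assms by auto
    have cos_deriv: "((\<lambda>v. cos (x * v) / v ^ 1) has_real_derivative - x * sin (x * v) / v - cos (x * v) / v ^ 2) (at v)"
      using v(1) by (auto intro!: derivative_eq_intros simp: field_simps power2_eq_square)
    have "((\<lambda>v. x * Si (x * v)) has_real_derivative x * (sinc (x * v) * x)) (at v)"
      by (intro DERIV_cmult DERIV_chain2[OF DERIV_Si]) (auto intro!: derivative_eq_intros)
    then have Si_deriv: "((\<lambda>v. x * Si (x * v)) has_real_derivative x * sin (x * v) / v) (at v)"
      using v by simp
    show "(F has_real_derivative - (cos (x * v) / v ^ 2)) (at v)"
      unfolding F_def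
      by (rule back_subst[where P = "\<lambda>D. (_ has_real_derivative D) (at v)",
            OF DERIV_add[OF cos_deriv Si_deriv]]) simp
  next
    show "(F \<longlongrightarrow> 0 + x * (pi / 2)) at_top"
      unfolding F_def using assms
      by (intro tendsto_add tendsto_mult tendsto_const tendsto_bounded_div_power_0
                filterlim_compose[OF Si_at_top]
                filterlim_tendsto_pos_mult_at_top[OF tendsto_const] filterlim_ident) auto
  next
    show "set_integrable lborel {1..} (\<lambda>v. - (cos (x * v) / v ^ 2))"
      using set_integrable_cosine[of 2 x] by (simp add: set_integrable_def)
  qed (auto intro!: continuous_intros)
  then show ?thesis
    by (simp add: F_def cosine_integral_def set_lebesgue_integral_def algebra_simps)
qed

text \<open>
  Integrating \<open>cos (x v) / v ^ m\<close> and \<open>cos (x v) / v ^ (m + 2)\<close> by parts both lead to the integral of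
  \<open>sin (x v) / v ^ (m + 1)\<close>. The combination below is the one in which this integral cancels, so
  that it has an elementary antiderivative.
\<close>

lemma cosine_integral_recurrence:
  assumes "m \<ge> 2"
  shows "x\<^sup>2 * cosine_integral m x + real m * real (m + 1) * cosine_integral (m + 2) x
       = real m * cos x - x * sin x"
proof -
  define F where "F = (\<lambda>v. x * (sin (x * v) / v ^ m) - real m * (cos (x * v) / v ^ (m + 1)))"
  let ?c = "\<lambda>n v. cos (x * v) / v ^ n"
  have int_scaled: "set_integrable lborel {1..} (\<lambda>v. b * ?c n v)" if "n \<ge> 2" for b :: real and n
    by (rule set_integrable_mult_right) (rule set_integrable_cosine[OF that])
  have "m + 2 \<ge> 2"
    by simp
  note int = int_scaled[OF assms, of "x\<^sup>2"] int_scaled[OF this, of "real m * real (m + 1)"]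
  have "(LINT v:{1..}|lborel. x\<^sup>2 * ?c m v + real m * real (m + 1) * ?c (m + 2) v)
      = (x * 0 - real m * 0) - F 1"
  proof (rule lborel_integral_FTC_atLeast)
    fix v :: real assume v: "v \<ge> 1"
    obtain l where l: "m = Suc l"
      using assms by (cases m) auto
    have sin_deriv: "((\<lambda>v. sin (x * v) / v ^ m) has_real_derivative
        x * ?c m v - real m * (sin (x * v) / v ^ (m + 1))) (at v)"
      by (rule derivative_eq_intros refl)+ (use v in \<open>simp_all add: l field_simps\<close>)
    have cos_deriv: "((\<lambda>v. ?c (m + 1) v) has_real_derivative
        - x * (sin (x * v) / v ^ (m + 1)) - real (m + 1) * ?c (m + 2) v) (at v)"
      by (rule derivative_eq_intros refl)+ (use v in \<open>simp_all add: l field_simps\<close>)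
    have combine: "x * (x * a - n * s) - n * (- x * s - n' * b) = x\<^sup>2 * a + n * n' * b"
      for a b s n n' :: real
      by (simp add: algebra_simps power2_eq_square)
    show "(F has_real_derivative x\<^sup>2 * ?c m v + real m * real (m + 1) * ?c (m + 2) v) (at v)"
      unfolding F_def
      using DERIV_diff[OF DERIV_cmult[OF sin_deriv, of x] DERIV_cmult[OF cos_deriv, of "real m"]]
      unfolding combine .
  next
    show "(F \<longlongrightarrow> x * 0 - real m * 0) at_top"
      unfolding F_def using assms
      by (intro tendsto_diff tendsto_mult_left tendsto_bounded_div_power_0[where g = "\<lambda>v. sin (x * v)"]
                tendsto_bounded_div_power_0[where g = "\<lambda>v. cos (x * v)"]) auto
  next
    show "continuous_on {1..} (\<lambda>v. x\<^sup>2 * ?c m v + real m * real (m + 1) * ?c (m + 2) v)"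
      by (intro continuous_intros) auto
  qed (rule set_integral_add(1)[OF int])
  also have "(LINT v:{1..}|lborel. x\<^sup>2 * ?c m v + real m * real (m + 1) * ?c (m + 2) v)
      = x\<^sup>2 * cosine_integral m x + real m * real (m + 1) * cosine_integral (m + 2) x"
    unfolding cosine_integral_def set_integral_add(2)[OF int] set_integral_mult_right ..
  finally show ?thesis
    by (simp add: F_def)
qed

lemma
  fixes k :: nat
  shows cos_pi_times_half_odd: "cos (pi * (real k + 1/2)) = 0"
    and sin_pi_times_half_odd: "sin (pi * (real k + 1/2)) = (-1) ^ k"
  by (simp_all add: distrib_left cos_add sin_add mult.commute[of pi] cos_npi sin_npi)

text \<open>
  The factor \<open>(-1) ^ p * Gamma (2 * p) / x ^ (2 * p - 1)\<close> normalises the cosine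
  integral: by the recurrence, consecutive normalised integrals differ by a boundary term only,
  so that they telescope.
\<close>

lemma Gamma_cosine_integral:
  fixes x :: real and k :: nat
  assumes "p \<ge> 1" "x > 0" and cos: "cos x = 0" and sin: "sin x = (-1) ^ k"
  shows "(-1) ^ p * Gamma (real (2 * p)) * (2 * cosine_integral (2 * p) x) / x ^ (2 * p - 1)
       = 2 * (-1) ^ k * (\<Sum>j=1..p-1. (-1) ^ j * Gamma (real (2 * j)) / x ^ (2 * j))
         - 2 * (Si x - pi / 2)"
  using \<open>p \<ge> 1\<close>
proof (induction p rule: dec_induct)
  case base
  have "Gamma (2 :: real) = 1"
    using Gamma_fact[of 1, where 'a = real] by simp
  then show ?case
    unfolding mult_1_right cosine_integral_2[OF \<open>x > 0\<close>] cos
    using \<open>x > 0\<close> by (simp add: field_simps)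
next
  case (step p)
  let ?C = "cosine_integral (2 * p) x" and ?C' = "cosine_integral (2 * p + 2) x"
    and ?G = "Gamma (real (2 * p))"
  have rec: "real (2 * p) * real (2 * p + 1) * ?C' = - x * (-1) ^ k - x\<^sup>2 * ?C"
    using cosine_integral_recurrence[of "2 * p" x] \<open>1 \<le> p\<close> cos sin by simp
  have "Gamma (real (2 * p) + 1 + 1) = (real (2 * p) + 1) * (real (2 * p) * ?G)"
    using \<open>1 \<le> p\<close> by (subst Gamma_plus1; (subst Gamma_plus1)?) (auto elim!: nonpos_Ints_cases)
  then have Gamma: "Gamma (real (2 * Suc p)) = real (2 * p) * real (2 * p + 1) * ?G"
    by (simp add: add_ac mult_ac)
  obtain q where p: "p = Suc q"
    using \<open>1 \<le> p\<close> by (cases p) auto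
  have "(-1) ^ Suc p * Gamma (real (2 * Suc p)) * (2 * cosine_integral (2 * Suc p) x) / x ^ (2 * Suc p - 1)
      = - ((-1) ^ p * ?G * 2 * (real (2 * p) * real (2 * p + 1) * ?C')) / x ^ (2 * p + 1)"
    unfolding Gamma by (simp add: mult_ac)
  also have "\<dots> = (-1) ^ p * ?G * (2 * ?C) / x ^ (2 * p - 1)
                  + 2 * (-1) ^ k * ((-1) ^ p * ?G / x ^ (2 * p))"
    unfolding rec using \<open>x > 0\<close> by (simp add: p field_simps power2_eq_square)
  also have "\<dots> = 2 * (-1) ^ k * (\<Sum>j=1..Suc p-1. (-1) ^ j * Gamma (real (2 * j)) / x ^ (2 * j))
         - 2 * (Si x - pi / 2)"
    unfolding step.IH by (simp add: p algebra_simps)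
  finally show ?case .
qed

theorem theoremD1:
  fixes p k :: nat
  assumes "p \<ge> 1"
  shows "(-1) ^ p * Gamma (of_nat (2 * p)) *
           ((E (2 * p) (- \<i> * of_real (pi * (real k + 1/2))) +
             E (2 * p) (\<i> * of_real (pi * (real k + 1/2)))) /
            of_real (pi * (real k + 1/2)) ^ (2 * p - 1))
       = of_real
          (2 * (-1) ^ k *
             (\<Sum>j=1..p-1. (-1) ^ j * Gamma (real (2 * j)) / (pi * (real k + 1/2)) ^ (2 * j))
           - 2 * (Si (pi * (real k + 1/2)) - pi / 2))"
proof -
  define x where "x = pi * (real k + 1/2)"
  have x: "x > 0" "cos x = 0" "sin x = (-1) ^ k"
    unfolding x_def cos_pi_times_half_odd sin_pi_times_half_odd by auto
  have Gamma: "Gamma (of_nat (2 * p)) = complex_of_real (Gamma (real (2 * p)))"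
    by (metis Gamma_complex_of_real of_real_of_nat_eq)
  have p: "2 * p \<ge> 2"
    using assms by simp
  have "(-1) ^ p * Gamma (of_nat (2 * p)) *
          ((E (2 * p) (- \<i> * of_real x) + E (2 * p) (\<i> * of_real x)) / of_real x ^ (2 * p - 1))
      = complex_of_real ((-1) ^ p * Gamma (real (2 * p)) * (2 * cosine_integral (2 * p) x)
                         / x ^ (2 * p - 1))"
    unfolding E_imaginary_add_E_minus[OF p] Gamma by simp
  also note Gamma_cosine_integral[OF assms x]
  finally show ?thesis
    unfolding x_def .
qed

end
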